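(* Let $A$ be a pseudo $BL$-algebra and $F$ an interval valued fuzzy set of $A$. Then for every interval number $\widehat t$ with $[0.5,0.5]<\widehat t\le[1,1]$ the level subset $F_{\widehat t}=\{x\in A\mid\widehat{\mu_F}(x)\ge\widehat t\}$, whenever nonempty, is a filter of $A$, if and only if for all $x,y\in A$: (F9) $\mathrm{rmax}\{\widehat{\mu_F}(x\odot y),[0.5,0.5]\}\ge\mathrm{rmin}\{\widehat{\mu_F}(x),\widehat{\mu_F}(y)\}$, and (F10) $\mathrm{rmax}\{\widehat{\mu_F}(y),[0.5,0.5]\}\ge\widehat{\mu_F}(x)$ whenever $x\le y$.
   Context: A pseudo $BL$-algebra is an algebra $(A;\wedge,\vee,\odot,\rightarrow,\hookrightarrow,0,1)$ of type $(2,2,2,2,2,0,0)$ such that $(A,\wedge,\vee,0,1)$ is a bounded lattice with lattice order $\le$, $(A,\odot,1)$ is a monoid, and for all $x,y,z\in A$: (a1) $x\odot y\le z\iff x\le y\rightarrow z\iff y\le x\hookrightarrow z$; (a2) $x\wedge y=(x\rightarrow y)\odot x=x\odot(x\hookrightarrow y)$; (a3) $(x\rightarrow y)\vee(y\rightarrow x)=(x\hookrightarrow y)\vee(y\hookrightarrow x)=1$. A filter of $A$ is a nonempty $I\subseteq A$ with $x\odot y\in I$ for $x,y\in I$, and $x\in I$, $x\le y$ imply $y\in I$. An interval number is $\widehat{a}=[a^{\bot},a^{\top}]$ with $0\le a^{\bot}\le a^{\top}\le 1$; $D[0,1]$ is the set of interval numbers. $\widehat{a}\le\widehat{b}$ iff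 $a^{\bot}\le b^{\bot}$ and $a^{\top}\le b^{\top}$; $\widehat{a}<\widehat{b}$ iff $\widehat{a}\le\widehat{b}$ and $\widehat{a}\ne\widehat{b}$; $\mathrm{rmin},\mathrm{rmax}$ are componentwise. An interval valued fuzzy set $F$ of $A$ is a map $\widehat{\mu_F}:A\to D[0,1]$; standing assumption: for every $x\in A$, either $\widehat{\mu_F}(x)<[0.5,0.5]$ or $[0.5,0.5]\le\widehat{\mu_F}(x)$. *)

theory Defs
  imports Complex_Main "HOL-Library.Product_Order"
begin

text \<open>The constants 0 and 1 of a pseudo BL-algebra are \<open>bot\<close> and \<open>top\<close> of the bounded lattice;
  neither \<open>bot \<noteq> top\<close> nor commutativity of \<open>\<odot>\<close> is required.\<close>

class pseudo_BL_algebra = bounded_lattice +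
  fixes odot :: "'a \<Rightarrow> 'a \<Rightarrow> 'a" (infixl "\<odot>" 75)
    and rimp :: "'a \<Rightarrow> 'a \<Rightarrow> 'a" (infixr "\<rightarrow>" 70)
    and himp :: "'a \<Rightarrow> 'a \<Rightarrow> 'a" (infixr "\<hookrightarrow>" 70)
  assumes odot_assoc: "(x \<odot> y) \<odot> z = x \<odot> (y \<odot> z)"
    and top_odot: "top \<odot> x = x"
    and odot_top: "x \<odot> top = x"
    and residuation_rimp: "x \<odot> y \<le> z \<longleftrightarrow> x \<le> (y \<rightarrow> z)"
    and residuation_himp: "x \<odot> y \<le> z \<longleftrightarrow> y \<le> (x \<hookrightarrow> z)"
    and divisibility_rimp: "inf x y = (x \<rightarrow> y) \<odot> x"
    and divisibility_himp: "inf x y = x \<odot> (x \<hookrightarrow> y)"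
    and prelinearity_rimp: "sup (x \<rightarrow> y) (y \<rightarrow> x) = top"
    and prelinearity_himp: "sup (x \<hookrightarrow> y) (y \<hookrightarrow> x) = top"

definition pBL_filter :: "'a::pseudo_BL_algebra set \<Rightarrow> bool" where
  "pBL_filter I \<longleftrightarrow> I \<noteq> {} \<and> (\<forall>x\<in>I. \<forall>y\<in>I. x \<odot> y \<in> I) \<and> (\<forall>x y. x \<in> I \<longrightarrow> x \<le> y \<longrightarrow> y \<in> I)"

text \<open>The interval number \<open>[a, b]\<close> is encoded as the pair \<open>(a, b)\<close>, so \<open>\<le>\<close> is the
  componentwise order from \<open>Product_Order\<close> and \<open><\<close> is its strict part.\<close>

definition interval_numbers :: "(real \<times> real) set" where
  "interval_numbers = {(a, b). 0 \<le> a \<and> a \<le> b \<and> b \<le> 1}"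

definition rmin :: "real \<times> real \<Rightarrow> real \<times> real \<Rightarrow> real \<times> real" where
  "rmin s t = (min (fst s) (fst t), min (snd s) (snd t))"

definition rmax :: "real \<times> real \<Rightarrow> real \<times> real \<Rightarrow> real \<times> real" where
  "rmax s t = (max (fst s) (fst t), max (snd s) (snd t))"

definition iv_fuzzy_set :: "('a \<Rightarrow> real \<times> real) \<Rightarrow> bool" where
  "iv_fuzzy_set \<mu> \<longleftrightarrow> (\<forall>x. \<mu> x \<in> interval_numbers)"

definition level_subset :: "('a \<Rightarrow> real \<times> real) \<Rightarrow> real \<times> real \<Rightarrow> 'a set" where
  "level_subset \<mu> t = {x. \<mu> x \<ge> t}"

end

theory Submission
  imports Defs
begin

text \<open>By \<open>le_sup_iff_of_comparable\<close>, on interval numbers comparable with \<open>h = [0.5, 0.5]\<close>,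
  the inequality \<open>s \<le> rmax u h\<close> says exactly that \<open>s \<le> u\<close> whenever \<open>h < s\<close>. Hence (F9) and (F10)
  yield closure of every level subset above \<open>h\<close>; conversely they follow from closure of the
  level subsets at \<open>t = rmin (\<mu> x) (\<mu> y)\<close> and \<open>t = \<mu> x\<close>.\<close>

lemma rmin_eq_inf: "rmin s t = inf s t"
  by (simp add: rmin_def prod_eq_iff inf_min)

lemma rmax_eq_sup: "rmax s t = sup s t"
  by (simp add: rmax_def prod_eq_iff sup_max)

lemma inf_interval_numbers:
  "s \<in> interval_numbers \<Longrightarrow> t \<in> interval_numbers \<Longrightarrow> inf s t \<in> interval_numbers"
  by (auto simp: interval_numbers_def inf_min)

lemma interval_numbers_le_one: "t \<in> interval_numbers \<Longrightarrow> t \<le> (1, 1)"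
  by (auto simp: interval_numbers_def)

text \<open>If \<open>h \<le> u\<close>, then \<open>sup u h = u\<close>, and any \<open>s\<close>
  not strictly above \<open>h\<close> satisfies \<open>s \<le> h \<le> u\<close>. If
  \<open>u < h\<close>, then \<open>sup u h = h\<close>, and by comparability both sides say that
  \<open>h < s\<close> fails.\<close>

lemma le_sup_iff_of_comparable:
  fixes h s u :: "'a::lattice"
  assumes "s < h \<or> h \<le> s" and "u < h \<or> h \<le> u"
  shows "s \<le> sup u h \<longleftrightarrow> (h < s \<longrightarrow> s \<le> u)"
  using assms
  by (metis le_supI1 less_le less_le_not_le sup.absorb1 sup.absorb2 sup.cobounded2)

text \<open>One argument strictly below \<open>h\<close> pulls the infimum strictly below; otherwise
  \<open>h\<close> is a common lower bound. This makes the previous lemma applicable to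
  \<open>rmin (\<mu> x) (\<mu> y)\<close>.\<close>

lemma inf_comparable:
  fixes h s u :: "'a::lattice"
  assumes "s < h \<or> h \<le> s" and "u < h \<or> h \<le> u"
  shows "inf s u < h \<or> h \<le> inf s u"
  using assms by (auto intro: less_infI1 less_infI2)

theorem theorem3p8:
  fixes \<mu> :: "'a::pseudo_BL_algebra \<Rightarrow> real \<times> real"
  assumes "iv_fuzzy_set \<mu>"
    and "\<forall>x. \<mu> x < (1/2, 1/2) \<or> (1/2, 1/2) \<le> \<mu> x"
  shows "(\<forall>t\<in>interval_numbers. (1/2, 1/2) < t \<and> t \<le> (1, 1) \<longrightarrow>
            level_subset \<mu> t \<noteq> {} \<longrightarrow> pBL_filter (level_subset \<mu> t))
     \<longleftrightarrow> (\<forall>x y. rmax (\<mu> (x \<odot> y)) (1/2, 1/2) \<ge> rmin (\<mu> x) (\<mu> y))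
       \<and> (\<forall>x y. x \<le> y \<longrightarrow> rmax (\<mu> y) (1/2, 1/2) \<ge> \<mu> x)"
proof -
  let ?h = "(1/2, 1/2) :: real \<times> real"
  have cmp: "\<mu> x < ?h \<or> ?h \<le> \<mu> x" for x
    using assms(2) by blast
  have int: "\<mu> x \<in> interval_numbers" for x
    using assms(1) by (simp add: iv_fuzzy_set_def)
  note F9_iff = le_sup_iff_of_comparable[OF inf_comparable[OF cmp cmp] cmp]
  note F10_iff = le_sup_iff_of_comparable[OF cmp cmp]
  show ?thesis
    unfolding rmin_eq_inf rmax_eq_sup F9_iff F10_iff
  proof (intro iffI conjI allI impI ballI)
    fix x y
    assume *: "\<forall>t\<in>interval_numbers. ?h < t \<and> t \<le> (1, 1) \<longrightarrow>
      level_subset \<mu> t \<noteq> {} \<longrightarrow> pBL_filter (level_subset \<mu> t)"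
    \<comment> \<open>The point \<open>z\<close> witnesses that the level subset is nonempty; the
      bound \<open>t \<le> (1, 1)\<close> holds for every interval number.\<close>
    have filter: "pBL_filter (level_subset \<mu> t)"
      if "t \<in> interval_numbers" "?h < t" "t \<le> \<mu> z" for t z
      using * that interval_numbers_le_one by (auto simp: level_subset_def)
    show "inf (\<mu> x) (\<mu> y) \<le> \<mu> (x \<odot> y)" if "?h < inf (\<mu> x) (\<mu> y)"
      using filter[OF inf_interval_numbers[OF int int] that inf_le1]
      by (simp add: pBL_filter_def level_subset_def)
    show "\<mu> x \<le> \<mu> y" if "x \<le> y" "?h < \<mu> x"
      using filter[OF int that(2) order_refl] that(1)
      by (auto simp: pBL_filter_def level_subset_def)
  next
    fix t
    assume *: "(\<forall>x y. ?h < inf (\<mu> x) (\<mu> y) \<longrightarrow> inf (\<mu> x) (\<mu> y) \<le> \<mu> (x \<odot> y)) \<and>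
        (\<forall>x y. x \<le> y \<longrightarrow> ?h < \<mu> x \<longrightarrow> \<mu> x \<le> \<mu> y)"
      and t: "?h < t \<and> t \<le> (1, 1)" and nonempty: "level_subset \<mu> t \<noteq> {}"
    \<comment> \<open>Since \<open>?h < t \<le> inf (\<mu> x) (\<mu> y)\<close>, the guard of the
      rewritten (F9) holds.\<close>
    have "t \<le> \<mu> (x \<odot> y)" if "t \<le> \<mu> x" "t \<le> \<mu> y" for x y
      using * t that by (meson le_infI less_le_trans order_trans)
    moreover have "t \<le> \<mu> y" if "t \<le> \<mu> x" "x \<le> y" for x y
      using * t that by (meson less_le_trans order_trans)
    ultimately show "pBL_filter (level_subset \<mu> t)"
      using nonempty by (auto simp: pBL_filter_def level_subset_def)
  qed
qed

end
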